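(* Let $H$ be a finite hypergraph. If Breaker has a winning strategy in the Maker-Breaker game on $H$, then Ophelia can force a draw when playing Tic-Tac-Toe on $H$. Similarly, if Xeno has a winning strategy in Tic-Tac-Toe on $H$, then Maker has a winning strategy in the Maker-Breaker game on $H$.
   Context: A hypergraph $H=(V,\mathcal{E})$ consists of a set $V$ of vertices and a set $\mathcal{E}$ of subsets of $V$ called hyperedges. Tic-Tac-Toe on $H$: two players, Xeno (first) and Ophelia (second), alternately choose vertices not chosen before; the first player to have chosen all the vertices of some hyperedge wins; if all vertices are chosen and nobody has completed a hyperedge, the game is a draw. Ophelia "can force a draw" if she has a strategy guaranteeing that Xeno does not win. The Maker-Breaker game on $H$: Maker and Breaker alternately choose vertices not chosen before, Maker moving first. Maker wins if he at some time has chosen all vertices of some hyperedge; Breaker wins if all vertices have been chosen and Maker has not completed a hyperedge. *)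

theory Defs
  imports Main
begin

definition hypergraph :: "'a set \<Rightarrow> 'a set set \<Rightarrow> bool" where
  "hypergraph V E \<longleftrightarrow> (\<forall>e\<in>E. e \<subseteq> V)"

definition finite_hypergraph :: "'a set \<Rightarrow> 'a set set \<Rightarrow> bool" where
  "finite_hypergraph V E \<longleftrightarrow> hypergraph V E \<and> finite V"

text \<open>
  In both games the first player (Xeno, Maker) and the second player (Ophelia, Breaker)
  alternate. A position is recorded as the list of all vertices chosen so far, oldest first,
  so the first player made the moves with even index.
\<close>

datatype player = First | Second

fun opponent :: "player \<Rightarrow> player" where
  "opponent First = Second"
| "opponent Second = First"

definition mover :: "nat \<Rightarrow> player" where
  "mover n = (if even n then First else Second)"

definition chosen :: "player \<Rightarrow> 'a list \<Rightarrow> 'a set" where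
  "chosen p xs = {xs ! i | i. i < length xs \<and> mover i = p}"

definition completed :: "'a set set \<Rightarrow> player \<Rightarrow> 'a list \<Rightarrow> bool" where
  "completed E p xs \<longleftrightarrow> (\<exists>e\<in>E. e \<subseteq> chosen p xs)"

text \<open>
  The predicate \<open>over\<close> says at which positions the game has ended; no move is made after that.
\<close>

definition legal_play :: "'a set \<Rightarrow> ('a list \<Rightarrow> bool) \<Rightarrow> 'a list \<Rightarrow> bool" where
  "legal_play V over xs \<longleftrightarrow>
     distinct xs \<and> set xs \<subseteq> V \<and> (\<forall>n<length xs. \<not> over (take n xs))"

definition complete_play :: "'a set \<Rightarrow> ('a list \<Rightarrow> bool) \<Rightarrow> 'a list \<Rightarrow> bool" where
  "complete_play V over xs \<longleftrightarrow> legal_play V over xs \<and> over xs"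

type_synonym 'a strategy = "'a list \<Rightarrow> 'a"

definition strategy_for ::
  "'a set \<Rightarrow> ('a list \<Rightarrow> bool) \<Rightarrow> player \<Rightarrow> 'a strategy \<Rightarrow> bool" where
  "strategy_for V over p s \<longleftrightarrow>
     (\<forall>xs. legal_play V over xs \<and> \<not> over xs \<and> mover (length xs) = p
        \<longrightarrow> s xs \<in> V - set xs)"

definition follows :: "player \<Rightarrow> 'a strategy \<Rightarrow> 'a list \<Rightarrow> bool" where
  "follows p s xs \<longleftrightarrow> (\<forall>n<length xs. mover n = p \<longrightarrow> xs ! n = s (take n xs))"

definition can_guarantee ::
  "'a set \<Rightarrow> ('a list \<Rightarrow> bool) \<Rightarrow> player \<Rightarrow> ('a list \<Rightarrow> bool) \<Rightarrow> bool" where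
  "can_guarantee V over p Q \<longleftrightarrow>
     (\<exists>s. strategy_for V over p s \<and>
          (\<forall>xs. complete_play V over xs \<and> follows p s xs \<longrightarrow> Q xs))"

text \<open>
  Tic-Tac-Toe. A single move can complete hyperedges for the player making it only, so
  requiring that the opponent has completed nothing at the same time matters only for an
  empty hyperedge: both players then have it from the start, and neither is the first.
\<close>

definition ttt_wins :: "'a set set \<Rightarrow> player \<Rightarrow> 'a list \<Rightarrow> bool" where
  "ttt_wins E p xs \<longleftrightarrow>
     (\<exists>n\<le>length xs. completed E p (take n xs) \<and>
        (\<forall>m\<le>n. \<not> completed E (opponent p) (take m xs)))"

definition ttt_over :: "'a set \<Rightarrow> 'a set set \<Rightarrow> 'a list \<Rightarrow> bool" where
  "ttt_over V E xs \<longleftrightarrow> (\<exists>p. ttt_wins E p xs) \<or> set xs = V"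

definition xeno_has_winning_strategy :: "'a set \<Rightarrow> 'a set set \<Rightarrow> bool" where
  "xeno_has_winning_strategy V E \<longleftrightarrow>
     can_guarantee V (ttt_over V E) First (ttt_wins E First)"

definition ophelia_can_force_draw :: "'a set \<Rightarrow> 'a set set \<Rightarrow> bool" where
  "ophelia_can_force_draw V E \<longleftrightarrow>
     can_guarantee V (ttt_over V E) Second (\<lambda>xs. \<not> ttt_wins E First xs)"

definition maker_wins :: "'a set set \<Rightarrow> 'a list \<Rightarrow> bool" where
  "maker_wins E xs \<longleftrightarrow> (\<exists>n\<le>length xs. completed E First (take n xs))"

definition breaker_wins :: "'a set \<Rightarrow> 'a set set \<Rightarrow> 'a list \<Rightarrow> bool" where
  "breaker_wins V E xs \<longleftrightarrow> set xs = V \<and> \<not> completed E First xs"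

definition mb_over :: "'a set \<Rightarrow> 'a set set \<Rightarrow> 'a list \<Rightarrow> bool" where
  "mb_over V E xs \<longleftrightarrow> maker_wins E xs \<or> breaker_wins V E xs"

definition maker_has_winning_strategy :: "'a set \<Rightarrow> 'a set set \<Rightarrow> bool" where
  "maker_has_winning_strategy V E \<longleftrightarrow>
     can_guarantee V (mb_over V E) First (maker_wins E)"

definition breaker_has_winning_strategy :: "'a set \<Rightarrow> 'a set set \<Rightarrow> bool" where
  "breaker_has_winning_strategy V E \<longleftrightarrow>
     can_guarantee V (mb_over V E) Second (breaker_wins V E)"

end

theory Submission imports Defs begin

text \<open>
  Stopping rules are the only difficulty, since Tic-Tac-Toe also stops when Ophelia completes
  a hyperedge. As long as nobody has won the Tic-Tac-Toe game, Xeno has completed nothing, so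
  every Tic-Tac-Toe play is a Maker-Breaker play and Breaker's strategy serves Ophelia
  unchanged (an empty hyperedge, which neither Tic-Tac-Toe player completes first, would break
  this, but then Maker has won from the start). Conversely, Maker follows Xeno's strategy until the Tic-Tac-Toe game ends; it ends
  at the latest when the board is full, and then Xeno, hence Maker, has completed a hyperedge.
\<close>

lemma chosen_take:
  "chosen p (take n xs) = {xs ! i | i. i < n \<and> i < length xs \<and> mover i = p}"
  unfolding chosen_def by (intro Collect_cong) (metis length_take min_less_iff_conj nth_take)

lemma chosen_mono: "n \<le> m \<Longrightarrow> chosen p (take n xs) \<subseteq> chosen p (take m xs)"
  unfolding chosen_take by (blast intro: less_le_trans)

lemma completed_mono:
  "completed E p (take n xs) \<Longrightarrow> n \<le> m \<Longrightarrow> completed E p (take m xs)"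
  unfolding completed_def using chosen_mono[of n m p xs] by (blast intro: subset_trans)

lemma completed_Nil: "completed E p [] \<longleftrightarrow> {} \<in> E"
  by (auto simp: completed_def chosen_def)

lemma chosen_take_Suc:
  assumes "mover n \<noteq> p"
  shows "chosen p (take (Suc n) xs) = chosen p (take n xs)"
  unfolding chosen_take using assms by (auto simp: less_Suc_eq)

lemma opponent_neq: "opponent p \<noteq> p"
  by (cases p) auto

text \<open>Chosen sets only grow, so an edge completed at some prefix is still completed at the
  end.\<close>

lemma maker_wins_iff: "maker_wins E xs \<longleftrightarrow> completed E First xs"
  unfolding maker_wins_def using completed_mono[of E First _ xs "length xs"] by fastforce

lemma ttt_wins_First_imp_completed: "ttt_wins E First xs \<Longrightarrow> completed E First xs"
  unfolding ttt_wins_def using completed_mono[of E First _ xs "length xs"] by fastforce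

text \<open>At the first prefix where anybody has completed an edge, only the player who has just
  moved can have done so: the other player's set did not change in that move. Hence that player
  wins.\<close>

lemma completed_imp_ttt_wins:
  assumes "{} \<notin> E" and "completed E p xs"
  shows "\<exists>q. ttt_wins E q xs"
proof -
  define P where "P n \<longleftrightarrow> (\<exists>q. completed E q (take n xs))" for n
  define k where "k = (LEAST n. P n)"
  have P: "P (length xs)"
    using assms(2) by (auto simp: P_def)
  have "P k" and k_le: "k \<le> length xs"
    unfolding k_def using P by (rule LeastI, rule Least_le)
  have least: "\<not> P n" if "n < k" for n
    using that unfolding k_def by (rule not_less_Least)
  obtain q where q: "completed E q (take k xs)"
    using \<open>P k\<close> P_def by blast
  \<comment> \<open>The argument needs a last move \<open>j\<close> leading to the prefix of length
    \<open>k\<close>; only an empty edge could be completed before any move.\<close>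
  have "k \<noteq> 0"
  proof
    assume "k = 0"
    with q assms(1) show False
      by (simp add: completed_Nil)
  qed
  then obtain j where j: "k = Suc j"
    by (cases k) auto
  have mover: "mover j = r" if "completed E r (take k xs)" for r
  proof (rule ccontr)
    assume "mover j \<noteq> r"
    from that have "completed E r (take j xs)"
      unfolding completed_def j chosen_take_Suc[OF \<open>mover j \<noteq> r\<close>] .
    then show False
      using least[of j] unfolding P_def j by blast
  qed
  have "\<not> completed E (opponent q) (take m xs)" if "m \<le> k" for m
  proof
    assume "completed E (opponent q) (take m xs)"
    from mover[OF completed_mono[OF this that]] mover[OF q] show False
      using opponent_neq[of q] by simp
  qed
  then show ?thesis
    unfolding ttt_wins_def using q k_le by blast
qed

lemma mb_over_imp_ttt_over:
  assumes "{} \<notin> E" and "mb_over V E xs"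
  shows "ttt_over V E xs"
  using assms completed_imp_ttt_wins[of E First xs]
  by (auto simp: mb_over_def ttt_over_def maker_wins_iff breaker_wins_def)

lemma legal_play_mono:
  assumes "legal_play V over xs" and "\<And>ys. over' ys \<Longrightarrow> over ys"
  shows "legal_play V over' xs"
  using assms by (auto simp: legal_play_def)

lemma legal_play_take: "legal_play V over xs \<Longrightarrow> legal_play V over (take n xs)"
  using set_take_subset[of n xs] by (auto simp: legal_play_def min_def)

text \<open>With an empty edge the game is over at \<open>[]\<close>, a play that follows every
  strategy vacuously and that Maker has won.\<close>

lemma breaker_wins_imp_empty_not_edge:
  assumes "breaker_has_winning_strategy V E"
  shows "{} \<notin> E"
proof
  assume "{} \<in> E"
  then have "completed E First []"
    by (simp add: completed_Nil)
  then have "complete_play V (mb_over V E) []"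
    by (simp add: complete_play_def legal_play_def mb_over_def maker_wins_iff)
  then have "breaker_wins V E []"
    using assms by (auto simp: breaker_has_winning_strategy_def can_guarantee_def follows_def)
  then show False
    using \<open>completed E First []\<close> by (simp add: breaker_wins_def)
qed

lemma breaker_imp_ophelia:
  assumes "breaker_has_winning_strategy V E"
  shows "ophelia_can_force_draw V E"
proof -
  note over = mb_over_imp_ttt_over[OF breaker_wins_imp_empty_not_edge[OF assms]]
  obtain s where s: "strategy_for V (mb_over V E) Second s"
    and win: "\<And>xs. complete_play V (mb_over V E) xs \<Longrightarrow> follows Second s xs
                \<Longrightarrow> breaker_wins V E xs"
    using assms by (auto simp: breaker_has_winning_strategy_def can_guarantee_def)
  have legal: "legal_play V (mb_over V E) xs" if "legal_play V (ttt_over V E) xs" for xs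
    using that over by (rule legal_play_mono)
  have "strategy_for V (ttt_over V E) Second s"
    using s legal over unfolding strategy_for_def by blast
  moreover have "\<not> ttt_wins E First xs"
    if xs: "complete_play V (ttt_over V E) xs" "follows Second s xs" for xs
  proof
    assume "ttt_wins E First xs"
    then have c: "completed E First xs"
      by (rule ttt_wins_First_imp_completed)
    \<comment> \<open>A Tic-Tac-Toe win of Xeno ends the Maker-Breaker game at the same position, so
      the guarantee of \<open>s\<close> applies there.\<close>
    then have "complete_play V (mb_over V E) xs"
      using xs(1) legal by (simp add: complete_play_def mb_over_def maker_wins_iff)
    from win[OF this xs(2)] c show False
      by (simp add: breaker_wins_def)
  qed
  ultimately show ?thesis
    unfolding ophelia_can_force_draw_def can_guarantee_def by blast
qed

lemma xeno_imp_maker: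
  assumes "xeno_has_winning_strategy V E"
  shows "maker_has_winning_strategy V E"
proof -
  let ?live = "\<lambda>xs. legal_play V (ttt_over V E) xs \<and> \<not> ttt_over V E xs"
  obtain s where s: "strategy_for V (ttt_over V E) First s"
    and win: "\<And>xs. complete_play V (ttt_over V E) xs \<Longrightarrow> follows First s xs
                \<Longrightarrow> ttt_wins E First xs"
    using assms by (auto simp: xeno_has_winning_strategy_def can_guarantee_def)
  \<comment> \<open>\<open>s\<close> is known to pick a free vertex only at \<open>?live\<close>
    positions. A Maker-Breaker play may go on after Ophelia has won, and from then on any free
    vertex will do.\<close>
  define t where "t xs = (if ?live xs then s xs else SOME v. v \<in> V - set xs)" for xs
  have "strategy_for V (mb_over V E) First t"
    unfolding strategy_for_def
  proof (intro allI impI, elim conjE)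
    fix xs
    assume xs: "legal_play V (mb_over V E) xs" "\<not> mb_over V E xs" "mover (length xs) = First"
    show "t xs \<in> V - set xs"
    proof (cases "?live xs")
      case True
      then show ?thesis
        using s xs(3) by (simp add: t_def strategy_for_def)
    next
      case False
      \<comment> \<open>A full board is won by Maker or by Breaker, so an unfinished game has a free
        vertex.\<close>
      have "set xs \<subseteq> V" "set xs \<noteq> V"
        using xs by (auto simp: legal_play_def mb_over_def maker_wins_iff breaker_wins_def)
      then have "\<exists>v. v \<in> V - set xs"
        by blast
      then show ?thesis
        unfolding t_def if_not_P[OF False] by (rule someI_ex)
    qed
  qed
  moreover have "maker_wins E xs"
    if xs: "complete_play V (mb_over V E) xs" "follows First t xs" for xs
  proof (rule ccontr)
    assume not_win: "\<not> maker_wins E xs"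
    define P where "P n \<longleftrightarrow> ttt_over V E (take n xs)" for n
    \<comment> \<open>\<open>k\<close> is the first moment at which Tic-Tac-Toe ends along
      \<open>xs\<close>; it exists because a play that Maker has not won fills the board.\<close>
    define k where "k = (LEAST n. P n)"
    have "set xs = V"
      using xs(1) not_win by (auto simp: complete_play_def mb_over_def breaker_wins_def)
    then have P: "P (length xs)"
      by (simp add: P_def ttt_over_def)
    have "P k" and k_le: "k \<le> length xs"
      unfolding k_def using P by (rule LeastI, rule Least_le)
    have least: "\<not> P n" if "n < k" for n
      using that unfolding k_def by (rule not_less_Least)
    have "distinct xs"
      using xs(1) by (simp add: complete_play_def legal_play_def)
    then have legal: "legal_play V (ttt_over V E) (take k xs)"
      using \<open>set xs = V\<close> least set_take_subset[of k xs] k_le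
      by (auto simp: legal_play_def P_def min_def)
    have live: "?live (take n xs)" if "n < k" for n
      using legal_play_take[OF legal, of n] least[OF that] that by (simp add: P_def min_def)
    \<comment> \<open>All prefixes shorter than \<open>k\<close> are live, so \<open>t\<close>
      agrees with \<open>s\<close> on them.\<close>
    have "follows First s (take k xs)"
      using xs(2) live k_le by (simp add: follows_def t_def min_def)
    moreover have "complete_play V (ttt_over V E) (take k xs)"
      using legal \<open>P k\<close> by (simp add: complete_play_def P_def)
    ultimately have "completed E First (take k xs)"
      using win ttt_wins_First_imp_completed by blast
    then show False
      using not_win k_le by (auto simp: maker_wins_def)
  qed
  ultimately show ?thesis
    unfolding maker_has_winning_strategy_def can_guarantee_def by blast
qed

theorem theorem1p1:
  fixes V :: "'a set" and E :: "'a set set"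
  assumes "finite_hypergraph V E"
  shows "(breaker_has_winning_strategy V E \<longrightarrow> ophelia_can_force_draw V E) \<and>
         (xeno_has_winning_strategy V E \<longrightarrow> maker_has_winning_strategy V E)"
  using breaker_imp_ophelia xeno_imp_maker by blast

end
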